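(* For every choice of constants $\varepsilon>0$ and $C \ge 1$ there exists $N=N(\varepsilon,C) \in \mathbb{N}$ such that for all integers $s,t$ with $N \le s \le t \le Cs$ there exists a graph $G$ that does not contain $K_{s,t}$ as a minor and whose list chromatic number satisfies $\chi_\ell(G) > (1-\varepsilon)(2s+t)$.
   Context: All graphs are finite, loopless and without parallel edges. $K_{s,t}$ denotes the complete bipartite graph with bipartition classes of sizes $s$ and $t$. A graph $G$ contains $F$ as a minor if there are pairwise disjoint non-empty sets $(Z_f)_{f\in V(F)}$ of vertices of $G$ such that each $G[Z_f]$ is connected and for every edge $f_1f_2$ of $F$ there is an edge of $G$ between $Z_{f_1}$ and $Z_{f_2}$. The list chromatic number $\chi_\ell(G)$ is the smallest $k\ge 1$ such that for every assignment of finite lists $L(v)\subseteq\mathbb{N}$ with $|L(v)|\ge k$ for all $v$, there is a proper coloring $c$ of $G$ with $c(v)\in L(v)$ for all $v$. *)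

theory Defs
  imports Complex_Main "Graph_Theory.Graph_Theory"
begin

text \<open>
  A finite simple graph is a \<^typ>\<open>'a pair_pre_digraph\<close> satisfying \<^const>\<open>pair_graph\<close>: the vertex
  set is finite and the adjacency relation \<^const>\<open>parcs\<close> is symmetric and irreflexive, so an
  undirected edge \<open>uv\<close> is the pair of arcs \<open>(u, v)\<close>, \<open>(v, u)\<close>.
\<close>

definition complete_bipartite :: "nat \<Rightarrow> nat \<Rightarrow> (nat + nat) pair_pre_digraph" where
  "complete_bipartite s t =
     \<lparr>pverts = {..<s} <+> {..<t},
      parcs = (Inl ` {..<s}) \<times> (Inr ` {..<t}) \<union> (Inr ` {..<t}) \<times> (Inl ` {..<s})\<rparr>"

lemma complete_bipartite_digraph_complete_bipartite:
  "complete_bipartite_digraph s t (with_proj (complete_bipartite s t))"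
  unfolding complete_bipartite_digraph_pair_def
proof (intro conjI exI)
  show "finite (pverts (complete_bipartite s t))"
    by (simp add: complete_bipartite_def)
  show "pverts (complete_bipartite s t) = Inl ` {..<s} \<union> Inr ` {..<t}"
    by (simp add: complete_bipartite_def Plus_def)
  show "parcs (complete_bipartite s t) =
      Inl ` {..<s} \<times> Inr ` {..<t} \<union> Inr ` {..<t} \<times> Inl ` {..<s}"
    by (simp add: complete_bipartite_def)
qed (auto simp: card_image)

lemma pair_graph_complete_bipartite: "pair_graph (complete_bipartite s t)"
  by (rule pair_graphI_complete_bipartite[OF complete_bipartite_digraph_complete_bipartite])

text \<open>\<open>has_minor G F\<close>: \<open>G\<close> contains \<open>F\<close> as a minor.\<close>

definition has_minor :: "'a pair_pre_digraph \<Rightarrow> 'b pair_pre_digraph \<Rightarrow> bool" where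
  "has_minor G F \<longleftrightarrow>
     (\<exists>Z :: 'b \<Rightarrow> 'a set.
        (\<forall>f \<in> pverts F. Z f \<noteq> {} \<and> Z f \<subseteq> pverts G \<and>
           Digraph_Component.connected (with_proj G \<restriction> Z f)) \<and>
        (\<forall>f \<in> pverts F. \<forall>g \<in> pverts F. f \<noteq> g \<longrightarrow> Z f \<inter> Z g = {}) \<and>
        (\<forall>(f, g) \<in> parcs F. \<exists>u \<in> Z f. \<exists>v \<in> Z g. (u, v) \<in> parcs G))"

definition proper_coloring :: "'a pair_pre_digraph \<Rightarrow> ('a \<Rightarrow> nat) \<Rightarrow> bool" where
  "proper_coloring G c \<longleftrightarrow> (\<forall>(u, v) \<in> parcs G. c u \<noteq> c v)"

definition list_colorable :: "'a pair_pre_digraph \<Rightarrow> nat \<Rightarrow> bool" where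
  "list_colorable G k \<longleftrightarrow>
     (\<forall>L :: 'a \<Rightarrow> nat set.
        (\<forall>v \<in> pverts G. finite (L v) \<and> k \<le> card (L v)) \<longrightarrow>
        (\<exists>c. proper_coloring G c \<and> (\<forall>v \<in> pverts G. c v \<in> L v)))"

definition list_chromatic_number :: "'a pair_pre_digraph \<Rightarrow> nat" where
  "list_chromatic_number G = (LEAST k. 1 \<le> k \<and> list_colorable G k)"

lemma (in pair_graph) list_colorable_card: "list_colorable G (card (pverts G))"
  unfolding list_colorable_def
proof (intro allI impI)
  fix L :: "'a \<Rightarrow> nat set"
  assume L: "\<forall>v \<in> pverts G. finite (L v) \<and> card (pverts G) \<le> card (L v)"
  have "\<exists>c. inj_on c S \<and> (\<forall>v \<in> S. c v \<in> L v)" if "finite S" "S \<subseteq> pverts G" for S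
    using that
  proof (induction S rule: finite_induct)
    case empty
    then show ?case by simp
  next
    case (insert x S)
    then obtain c where c: "inj_on c S" "\<forall>v \<in> S. c v \<in> L v" by auto
    have "card (c ` S) \<le> card S"
      using insert.hyps by (simp add: card_image_le)
    also have "card S < card (insert x S)"
      using insert.hyps by simp
    also have "\<dots> \<le> card (pverts G)"
      using insert.prems pair_finite_verts by (simp add: card_mono)
    also have "\<dots> \<le> card (L x)"
      using L insert.prems by simp
    finally have "\<not> L x \<subseteq> c ` S"
      using insert.hyps by (meson card_mono finite_imageI leD)
    then obtain a where a: "a \<in> L x" "a \<notin> c ` S" by blast
    have "inj_on (c(x := a)) (insert x S)"
      using c(1) a(2) insert.hyps by (auto simp: inj_on_def)
    moreover have "\<forall>v \<in> insert x S. (c(x := a)) v \<in> L v"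
      using c(2) a(1) by simp
    ultimately show ?case by blast
  qed
  from this[OF pair_finite_verts order_refl] obtain c
    where c: "inj_on c (pverts G)" "\<forall>v \<in> pverts G. c v \<in> L v" by blast
  have "proper_coloring G c"
    unfolding proper_coloring_def
    using c(1) pair_no_loops by (fastforce dest: in_arcsD1 in_arcsD2 inj_onD)
  with c(2) show "\<exists>c. proper_coloring G c \<and> (\<forall>v \<in> pverts G. c v \<in> L v)" by blast
qed

lemma (in pair_graph) list_chromatic_number_attained:
  "1 \<le> list_chromatic_number G \<and> list_colorable G (list_chromatic_number G)"
proof -
  have "list_colorable G (max 1 (card (pverts G)))"
    using list_colorable_card unfolding list_colorable_def by simp
  then show ?thesis
    unfolding list_chromatic_number_def
    by (intro LeastI[where P = "\<lambda>k. 1 \<le> k \<and> list_colorable G k"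
          and k = "max 1 (card (pverts G))"]) simp
qed

end

theory Submission
  imports Defs "HOL-Library.FuncSet" "HOL-Library.Disjoint_Sets" "HOL-Real_Asymp.Real_Asymp"
begin

text \<open>
  Take cliques \<open>A\<close> and \<open>B\<close> with slightly fewer than \<open>s\<close> and \<open>s + t\<close> vertices, joined completely
  except for a sparse random set \<open>R\<close> of missing edges such that any two large families of bounded-size
  disjoint sets in \<open>A\<close> and in \<open>B\<close> contain a pair with no edge between them. In a bipartite model most
  branch sets are small, so, up to few exceptions, either all sets of one class meet \<open>A\<close> or all sets
  of both classes meet \<open>B\<close>; this contradicts \<open>|A| < s\<close> or \<open>|B| < s + t\<close>.

  Glue copies of \<open>B\<close> along \<open>A\<close>, one for each colouring \<open>\<kappa>\<close> of \<open>A\<close> with \<open>|A| + |B| - 1\<close> colours. As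
  \<open>|A| < s\<close>, a model of \<open>K\<^sub>s\<^sub>,\<^sub>t\<close> restricts to \<open>A\<close> and a single copy. In the copy for \<open>\<kappa>\<close>, delete from the list
  of \<open>y\<close> the colours that \<open>\<kappa>\<close> gives to the non-neighbours of \<open>y\<close>: then no colouring extending \<open>\<kappa>\<close>
  can repeat a colour on \<open>A\<close> and that copy, so there are too few colours.
\<close>

section \<open>A sparse relation that is dense on families of small sets\<close>

text \<open>Independence in counting form: a uniformly random \<open>f\<close> agrees with
  \<open>\<tau>\<close> on a whole cell with probability at least \<open>1 / card Q ^ L\<close>, and
  disjointness of the cells makes these events independent. The induction strips off one
  cell.\<close>

lemma card_avoiding_cells_le:
  fixes P :: "'m \<Rightarrow> 'd set" and D :: "'d set" and Q :: "'c set"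
  assumes "finite M" "finite D" "finite Q" "\<tau> \<in> D \<rightarrow> Q" "Q \<noteq> {}"
    and "\<And>m. m \<in> M \<Longrightarrow> P m \<subseteq> D \<and> card (P m) \<le> L"
    and "disjoint_family_on P M"
  shows "real (card {f \<in> D \<rightarrow>\<^sub>E Q. \<forall>m\<in>M. \<exists>x\<in>P m. f x \<noteq> \<tau> x})
          \<le> real (card Q) ^ card D * (1 - 1 / real (card Q) ^ L) ^ card M"
  using assms
proof (induction M arbitrary: D rule: finite_induct)
  case empty
  then show ?case
    by (simp add: card_funcsetE)
next
  case (insert m M D)
  let ?q = "real (card Q)" and ?p = "card (P m)"
  define D' where "D' = D - P m"
  have q: "?q \<ge> 1"
    using insert.prems(2,4) by (simp add: Suc_leI card_gt_0_iff)
  have Pm: "P m \<subseteq> D" "?p \<le> L"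
    using insert.prems(5) by auto
  then have finPm: "finite (P m)"
    using insert.prems(1) finite_subset by auto
  have disj: "P k \<inter> P m = {}" if "k \<in> M" for k
    using insert.prems(6) insert.hyps(2) that by (metis disjoint_family_on_def insertCI)
  have PM: "P k \<subseteq> D' \<and> card (P k) \<le> L" if "k \<in> M" for k
    using insert.prems(5)[of k] disj[OF that] that unfolding D'_def by blast
  let ?B = "\<lambda>D M. {f \<in> D \<rightarrow>\<^sub>E Q. \<forall>m\<in>M. \<exists>x\<in>P m. f x \<noteq> \<tau> x}"
  let ?U = "(P m \<rightarrow>\<^sub>E Q) - {restrict \<tau> (P m)}"
  have finD': "finite D'"
    using insert.prems(1) by (simp add: D'_def)
  then have fin': "finite (?B D' M)"
    using finite_PiE[OF finD', of "\<lambda>_. Q"] insert.prems(2) by simp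
  have IH: "real (card (?B D' M)) \<le> ?q ^ card D' * (1 - 1 / ?q ^ L) ^ card M"
  proof (rule insert.IH[OF finD' insert.prems(2) _ insert.prems(4) PM])
    show "\<tau> \<in> D' \<rightarrow> Q"
      using insert.prems(3) by (auto simp: D'_def)
    show "disjoint_family_on P M"
      using insert.prems(6) by (rule disjoint_family_on_mono[rotated]) blast
  qed
  \<comment> \<open>\<open>f\<close> is split into its values on the cell \<open>P m\<close> and on
    the rest \<open>D'\<close>; on the cell exactly one function,
    \<open>restrict \<tau> (P m)\<close>, is forbidden.\<close>
  let ?\<phi> = "\<lambda>f. (restrict f (P m), restrict f D')"
  have "inj_on ?\<phi> (?B D (insert m M))"
  proof (rule inj_onI)
    fix f g assume fg: "f \<in> ?B D (insert m M)" "g \<in> ?B D (insert m M)" "?\<phi> f = ?\<phi> g"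
    have eq: "f x = g x" if "x \<in> D" for x
    proof (cases "x \<in> P m")
      case True
      then show ?thesis
        using fg(3) by (metis prod.inject restrict_apply')
    next
      case False
      then have "x \<in> D'"
        using that by (simp add: D'_def)
      then show ?thesis
        using fg(3) by (metis prod.inject restrict_apply')
    qed
    have "f \<in> D \<rightarrow>\<^sub>E Q" "g \<in> D \<rightarrow>\<^sub>E Q"
      using fg(1,2) by simp_all
    then show "f = g"
      by (rule PiE_ext) (rule eq)
  qed
  moreover have "?\<phi> ` ?B D (insert m M) \<subseteq> ?U \<times> ?B D' M"
  proof (rule image_subsetI)
    fix f assume f: "f \<in> ?B D (insert m M)"
    then obtain x where x: "x \<in> P m" "f x \<noteq> \<tau> x"
      by blast
    then have "restrict f (P m) x \<noteq> restrict \<tau> (P m) x"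
      by simp
    then have "restrict f (P m) \<noteq> restrict \<tau> (P m)"
      by metis
    moreover have "\<exists>x\<in>P k. restrict f D' x \<noteq> \<tau> x" if "k \<in> M" for k
    proof -
      from f that obtain z where z: "z \<in> P k" "f z \<noteq> \<tau> z"
        by blast
      moreover have "z \<in> D'"
        using PM[OF that] z by auto
      ultimately show ?thesis
        by (intro bexI[of _ z]) simp_all
    qed
    moreover have "restrict f (P m) \<in> P m \<rightarrow>\<^sub>E Q" "restrict f D' \<in> D' \<rightarrow>\<^sub>E Q"
      using f Pm(1) by (auto simp: D'_def)
    ultimately show "?\<phi> f \<in> ?U \<times> ?B D' M"
      by simp
  qed
  moreover have "finite (?U \<times> ?B D' M)"
    using fin' finite_PiE[OF finPm, of "\<lambda>_. Q"] insert.prems(2) by simp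
  ultimately have "card (?B D (insert m M)) \<le> card (?U \<times> ?B D' M)"
    by (rule card_inj_on_le)
  then have "real (card (?B D (insert m M))) \<le> real (card ?U) * real (card (?B D' M))"
    unfolding card_cartesian_product of_nat_mult[symmetric] of_nat_le_iff .
  also have "real (card ?U) = ?q ^ ?p - 1"
  proof -
    have "restrict \<tau> (P m) \<in> P m \<rightarrow>\<^sub>E Q"
      using insert.prems(3) Pm by auto
    then have "card ?U = card Q ^ ?p - 1"
      using finPm by (simp add: card_funcsetE)
    moreover have "1 \<le> card Q ^ ?p"
      using q by simp
    ultimately show ?thesis
      by (simp add: of_nat_diff)
  qed
  also have "(?q ^ ?p - 1) * real (card (?B D' M))
      \<le> (?q ^ ?p * (1 - 1 / ?q ^ L)) * (?q ^ card D' * (1 - 1 / ?q ^ L) ^ card M)"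
  proof (rule mult_mono[OF _ IH])
    have "?q ^ ?p \<le> ?q ^ L"
      using q Pm by (intro power_increasing) auto
    then have "?q ^ ?p / ?q ^ L \<le> 1"
      using q by (simp add: divide_le_eq_1)
    then show "?q ^ ?p - 1 \<le> ?q ^ ?p * (1 - 1 / ?q ^ L)"
      by (simp add: right_diff_distrib)
    show "0 \<le> ?q ^ ?p * (1 - 1 / ?q ^ L)"
      using q by simp
  qed simp
  also have "\<dots> = ?q ^ (?p + card D') * (1 - 1 / ?q ^ L) ^ Suc (card M)"
    by (simp add: power_add)
  also have "?p + card D' = card D"
    unfolding D'_def using Pm(1) finPm insert.prems(1) by (simp add: card_Diff_subset card_mono)
  also have "Suc (card M) = card (insert m M)"
    using insert.hyps by simp
  finally show ?case .
qed

text \<open>\<open>R\<close> will be the relation of non-adjacency, so the pair \<open>S i\<close>,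
  \<open>T k\<close> spans no edge.\<close>

definition dense_on_families :: "nat \<Rightarrow> nat \<Rightarrow> nat \<Rightarrow> nat \<Rightarrow> (nat \<Rightarrow> nat \<Rightarrow> bool) \<Rightarrow> bool" where
  "dense_on_families r K a b R \<longleftrightarrow>
     (\<forall>S T. (\<forall>i<r. S i \<subseteq> {..<a} \<and> card (S i) \<le> K) \<longrightarrow> disjoint_family_on S {..<r} \<longrightarrow>
       (\<forall>i<r. T i \<subseteq> {..<b} \<and> card (T i) \<le> K) \<longrightarrow> disjoint_family_on T {..<r} \<longrightarrow>
       (\<exists>i<r. \<exists>k<r. \<forall>x\<in>S i. \<forall>y\<in>T k. R x y))"

text \<open>Union bound for a random \<open>f\<close> on the grid, with \<open>R x y\<close> meaning
  \<open>f (x, y) = j y\<close>. Families of \<open>r\<close> disjoint sets are the fibres of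
  labellings with \<open>r + 1\<close> labels, so at most \<open>Suc r ^ (a + b) * q ^ b\<close>
  events must be avoided. Each has small probability by \<open>card_avoiding_cells_le\<close>: the
  \<open>r * r\<close> products of fibres are disjoint cells of size at most
  \<open>K * K\<close>.\<close>

lemma exists_sparse_relation:
  fixes a b q r K :: nat
  assumes q: "0 < q"
    and small: "real (Suc r) ^ (a + b) * real q ^ b * (1 - 1 / real q ^ (K * K)) ^ (r * r) < 1"
  obtains R :: "nat \<Rightarrow> nat \<Rightarrow> bool" where
    "\<And>y. y < b \<Longrightarrow> q * card {x. x < a \<and> R x y} \<le> a"
    "dense_on_families r K a b R"
proof -
  define D where "D = {..<a} \<times> {..<b}"
  define fib where "fib = (\<lambda>(g :: nat \<Rightarrow> nat) n i. {x. x < (n::nat) \<and> g x = i})"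
  define small_fib where "small_fib = (\<lambda>g n. \<forall>i<r. card (fib g n i) \<le> K)"
  \<comment> \<open>The value \<open>j y\<close> defining \<open>R\<close> in row \<open>y\<close> will be the rarest one, which bounds the degrees with no
    further probability estimate; the union bound over all \<open>j\<close> only costs a factor \<open>q ^ b\<close>.\<close>
  define Bad where "Bad = (\<lambda>(g, h, j :: nat \<Rightarrow> nat). {f \<in> D \<rightarrow>\<^sub>E {..<q}.
      \<forall>m\<in>{..<r} \<times> {..<r}. \<exists>z \<in> fib g a (fst m) \<times> fib h b (snd m). f z \<noteq> j (snd z)})"
  define I where "I = {g \<in> {..<a} \<rightarrow>\<^sub>E {..r}. small_fib g a} \<times>
      {h \<in> {..<b} \<rightarrow>\<^sub>E {..r}. small_fib h b} \<times> ({..<b} \<rightarrow>\<^sub>E {..<q})"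
  let ?J = "({..<a} \<rightarrow>\<^sub>E {..r}) \<times> ({..<b} \<rightarrow>\<^sub>E {..r}) \<times> ({..<b} \<rightarrow>\<^sub>E {..<q})"
  let ?\<theta> = "(1 - 1 / real q ^ (K * K)) ^ (r * r)"
  have finJ: "finite ?J"
    by (intro finite_cartesian_product finite_PiE) auto
  have IJ: "I \<subseteq> ?J"
    by (auto simp: I_def)
  have finI: "finite I"
    using finJ IJ by (rule finite_subset[rotated])
  have cardI: "card I \<le> Suc r ^ (a + b) * q ^ b"
    using card_mono[OF finJ IJ] by (simp add: card_cartesian_product card_funcsetE power_add mult.assoc)
  have bad: "real (card (Bad w)) \<le> real q ^ (a * b) * ?\<theta>" if "w \<in> I" for w
  proof -
    obtain g h j where w: "w = (g, h, j)" and g: "small_fib g a" and h: "small_fib h b"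
      and j: "j \<in> {..<b} \<rightarrow>\<^sub>E {..<q}"
      using \<open>w \<in> I\<close> by (auto simp: I_def)
    have "real (card {f \<in> D \<rightarrow>\<^sub>E {..<q}. \<forall>m\<in>{..<r} \<times> {..<r}.
          \<exists>z \<in> fib g a (fst m) \<times> fib h b (snd m). f z \<noteq> j (snd z)})
        \<le> real (card {..<q}) ^ card D * (1 - 1 / real (card {..<q}) ^ (K * K)) ^ card ({..<r} \<times> {..<r})"
    proof (rule card_avoiding_cells_le[where P = "\<lambda>m. fib g a (fst m) \<times> fib h b (snd m)"
          and \<tau> = "\<lambda>z. j (snd z)"])
      show "(\<lambda>z. j (snd z)) \<in> D \<rightarrow> {..<q}"
        using PiE_mem[OF j] unfolding D_def by force
      show "fib g a (fst m) \<times> fib h b (snd m) \<subseteq> D \<and> card (fib g a (fst m) \<times> fib h b (snd m)) \<le> K * K"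
        if "m \<in> {..<r} \<times> {..<r}" for m
      proof
        show "fib g a (fst m) \<times> fib h b (snd m) \<subseteq> D"
          by (auto simp: fib_def D_def)
        have "card (fib g a (fst m)) \<le> K" "card (fib h b (snd m)) \<le> K"
          using that g h by (auto simp: small_fib_def)
        then show "card (fib g a (fst m) \<times> fib h b (snd m)) \<le> K * K"
          unfolding card_cartesian_product by (rule mult_le_mono)
      qed
      show "disjoint_family_on (\<lambda>m. fib g a (fst m) \<times> fib h b (snd m)) ({..<r} \<times> {..<r})"
        by (auto simp: fib_def disjoint_family_on_def)
      show "{..<q} \<noteq> {}"
        using q by auto
    qed (simp_all add: D_def)
    then show ?thesis
      by (simp add: w Bad_def D_def)
  qed
  have "finite (D \<rightarrow>\<^sub>E {..<q})"
    by (intro finite_PiE) (auto simp: D_def)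
  then have finBad: "finite (Bad w)" for w
    by (cases w) (simp add: Bad_def)
  have "real (card (\<Union>w\<in>I. Bad w)) \<le> (\<Sum>w\<in>I. real (card (Bad w)))"
    using card_UN_le[OF finI, of Bad] unfolding of_nat_sum[symmetric] of_nat_le_iff .
  also have "\<dots> \<le> real (card I) * (real q ^ (a * b) * ?\<theta>)"
    using sum_mono[OF bad] by (simp add: mult.assoc)
  also have "\<dots> \<le> (real (Suc r) ^ (a + b) * real q ^ b) * (real q ^ (a * b) * ?\<theta>)"
  proof (rule mult_right_mono)
    show "real (card I) \<le> real (Suc r) ^ (a + b) * real q ^ b"
      using cardI unfolding of_nat_power[symmetric] of_nat_mult[symmetric] of_nat_le_iff .
    show "0 \<le> real q ^ (a * b) * ?\<theta>"
      using q by simp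
  qed
  also have "\<dots> = real q ^ (a * b) * (real (Suc r) ^ (a + b) * real q ^ b * ?\<theta>)"
    by (simp only: ac_simps)
  also have "\<dots> < real q ^ (a * b) * 1"
    using q small by (intro mult_strict_left_mono) auto
  also have "\<dots> = real (card (D \<rightarrow>\<^sub>E {..<q}))"
    by (simp add: D_def card_funcsetE)
  finally have "\<not> (D \<rightarrow>\<^sub>E {..<q}) \<subseteq> (\<Union>w\<in>I. Bad w)"
    using finI finBad by (meson card_mono finite_UN_I linorder_not_le of_nat_less_iff)
  then obtain f where f: "f \<in> D \<rightarrow>\<^sub>E {..<q}" and fI: "\<And>w. w \<in> I \<Longrightarrow> f \<notin> Bad w"
    by blast
  \<comment> \<open>Averaging: the \<open>q\<close> level sets of \<open>f\<close> in row
    \<open>y\<close> partition \<open>a\<close> points, so one of them has at most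
    \<open>a / q\<close>.\<close>
  have "\<exists>c<q. q * card {x. x < a \<and> f (x, y) = c} \<le> a" if "y < b" for y
  proof (rule ccontr)
    assume "\<not> ?thesis"
    then have "(\<Sum>c<q. a) < (\<Sum>c<q. q * card {x. x < a \<and> f (x, y) = c})"
      using q by (intro sum_strict_mono) auto
    also have "\<dots> = q * card (\<Union>c<q. {x. x < a \<and> f (x, y) = c})"
      by (subst card_UN_disjoint) (auto simp: sum_distrib_left)
    also have "\<dots> \<le> q * card {..<a}"
      by (intro mult_left_mono card_mono) auto
    finally show False by simp
  qed
  then obtain j0 where j0: "\<And>y. y < b \<Longrightarrow> j0 y < q \<and> q * card {x. x < a \<and> f (x, y) = j0 y} \<le> a"
    by metis
  \<comment> \<open>The spare label \<open>r\<close> marks points outside every \<open>S i\<close>;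
    for disjoint sets the \<open>SOME\<close> picks the only possible index.\<close>
  define label where "label = (\<lambda>(S :: nat \<Rightarrow> nat set) n.
    \<lambda>x\<in>{..<n}. if \<exists>i<r. x \<in> S i then SOME i. i < r \<and> x \<in> S i else r)"
  have label_in: "label S n \<in> {..<n} \<rightarrow>\<^sub>E {..r}" for S and n :: nat
  proof -
    have "(SOME i. i < r \<and> x \<in> S i) \<le> r" if "\<exists>i<r. x \<in> S i" for x
      using someI_ex[OF that] by simp
    then show ?thesis
      by (auto simp: label_def)
  qed
  have fib_label: "fib (label S n) n i = S i"
    if "\<forall>i<r. S i \<subseteq> {..<n} \<and> card (S i) \<le> K" "disjoint_family_on S {..<r}" "i < r" for S n i
  proof -
    have "label S n x = i \<longleftrightarrow> x \<in> S i" if "x < n" for x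
    proof (cases "\<exists>k<r. x \<in> S k")
      case True
      let ?k = "SOME k. k < r \<and> x \<in> S k"
      have "?k < r" "x \<in> S ?k"
        using someI_ex[OF True] by auto
      then have "?k = i \<longleftrightarrow> x \<in> S i"
        using \<open>disjoint_family_on S {..<r}\<close> \<open>i < r\<close> by (auto simp: disjoint_family_on_def)
      then show ?thesis
        using True \<open>x < n\<close> by (simp add: label_def)
    next
      case False
      then show ?thesis
        using \<open>x < n\<close> \<open>i < r\<close> by (auto simp: label_def)
    qed
    then show ?thesis
      using that by (auto simp: fib_def)
  qed
  show thesis
  proof (rule that[of "\<lambda>x y. f (x, y) = j0 y"])
    show "q * card {x. x < a \<and> f (x, y) = j0 y} \<le> a" if "y < b" for y
      using j0[OF that] by blast
  next
    show "dense_on_families r K a b (\<lambda>x y. f (x, y) = j0 y)"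
      unfolding dense_on_families_def
    proof (intro allI impI)
      fix S T
      assume S: "\<forall>i<r. S i \<subseteq> {..<a} \<and> card (S i) \<le> K" "disjoint_family_on S {..<r}"
        and T: "\<forall>i<r. T i \<subseteq> {..<b} \<and> card (T i) \<le> K" "disjoint_family_on T {..<r}"
      \<comment> \<open>\<open>I\<close> holds extensional functions only, hence the restriction of
        \<open>j0\<close>. As \<open>f\<close> is not bad for this index, it equals
        \<open>j0\<close> throughout some product of fibres.\<close>
      have "(label S a, label T b, restrict j0 {..<b}) \<in> I"
        using label_in S T j0 by (auto simp: I_def small_fib_def fib_label)
      from fI[OF this] f obtain i k where ik: "i < r" "k < r"
        and eq: "\<forall>z \<in> fib (label S a) a i \<times> fib (label T b) b k. f z = restrict j0 {..<b} (snd z)"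
        unfolding Bad_def by fastforce
      have "\<forall>x\<in>S i. \<forall>y\<in>T k. f (x, y) = j0 y"
        using eq ik T(1) unfolding fib_label[OF S ik(1)] fib_label[OF T ik(2)] by fastforce
      with ik show "\<exists>i<r. \<exists>k<r. \<forall>x\<in>S i. \<forall>y\<in>T k. f (x, y) = j0 y"
        by blast
    qed
  qed
qed

section \<open>Bipartite models in two cliques\<close>

text \<open>Limits the number of branch sets that can meet a clique with \<open>n\<close>
  vertices.\<close>

lemma card_nonempty_disjoint_le:
  assumes "finite W" "disjoint_family_on S W" "\<And>w. w \<in> W \<Longrightarrow> S w \<noteq> {} \<and> S w \<subseteq> {..<n::nat}"
  shows "card W \<le> n"
proof -
  have "1 \<le> card (S w)" if "w \<in> W" for w
    using assms(3)[OF that] by (metis One_nat_def Suc_leI card_gt_0_iff finite_lessThan finite_subset)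
  then have "card W \<le> (\<Sum>w\<in>W. card (S w))"
    using sum_mono[of W "\<lambda>_. 1" "\<lambda>w. card (S w)"] by simp
  also have "\<dots> = card (\<Union>w\<in>W. S w)"
    using assms by (intro card_UN_disjoint'[symmetric]) (auto intro: finite_subset)
  also have "\<dots> \<le> card {..<n}"
    using assms(3) by (intro card_mono) auto
  finally show ?thesis by simp
qed

text \<open>Transfers density from families indexed by \<open>{..<r}\<close> to arbitrary index
  sets, by injecting \<open>r\<close> indices into each.\<close>

lemma exists_dense_pair:
  fixes S T :: "'i \<Rightarrow> nat set" and R :: "nat \<Rightarrow> nat \<Rightarrow> bool"
  assumes R: "dense_on_families r K a b R"
    and "finite U" "finite V" "r \<le> card U" "r \<le> card V"
    and S: "\<And>u. u \<in> U \<Longrightarrow> S u \<subseteq> {..<a} \<and> card (S u) \<le> K" "disjoint_family_on S U"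
    and T: "\<And>v. v \<in> V \<Longrightarrow> T v \<subseteq> {..<b} \<and> card (T v) \<le> K" "disjoint_family_on T V"
  shows "\<exists>u\<in>U. \<exists>v\<in>V. \<forall>x\<in>S u. \<forall>y\<in>T v. R x y"
proof -
  obtain \<phi> where \<phi>: "\<phi> ` {..<r} \<subseteq> U" "inj_on \<phi> {..<r}"
    using card_le_inj[of "{..<r}" U] assms(2,4) by auto
  obtain \<psi> where \<psi>: "\<psi> ` {..<r} \<subseteq> V" "inj_on \<psi> {..<r}"
    using card_le_inj[of "{..<r}" V] assms(3,5) by auto
  have "\<exists>i<r. \<exists>k<r. \<forall>x\<in>S (\<phi> i). \<forall>y\<in>T (\<psi> k). R x y"
  proof (rule R[unfolded dense_on_families_def, THEN spec, of "\<lambda>i. S (\<phi> i)", THEN spec,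
        of "\<lambda>i. T (\<psi> i)", THEN mp, THEN mp, THEN mp, THEN mp])
    show "disjoint_family_on (\<lambda>i. S (\<phi> i)) {..<r}"
      using S(2) \<phi> by (simp add: disjoint_family_on_def inj_on_def image_subset_iff) metis
    show "disjoint_family_on (\<lambda>i. T (\<psi> i)) {..<r}"
      using T(2) \<psi> by (simp add: disjoint_family_on_def inj_on_def image_subset_iff) metis
  qed (use S(1) T(1) \<phi>(1) \<psi>(1) in \<open>auto simp: image_subset_iff\<close>)
  then obtain i k where "i < r" "k < r" "\<forall>x\<in>S (\<phi> i). \<forall>y\<in>T (\<psi> k). R x y"
    by blast
  moreover from this have "\<phi> i \<in> U" "\<psi> k \<in> V"
    using \<phi>(1) \<psi>(1) by auto
  ultimately show ?thesis
    by blast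
qed

text \<open>
  \<open>SA f\<close> and \<open>SB f\<close> are the traces of the branch set of \<open>f\<close> on the two cliques. An edge between two
  branch sets has to be asked for only when each of them lies in one clique and not in the same one.
\<close>
lemma no_bipartite_model_in_two_cliques:
  fixes SA SB :: "'i \<Rightarrow> nat set" and R :: "nat \<Rightarrow> nat \<Rightarrow> bool"
  assumes R: "dense_on_families r K a b R"
    and fin: "finite X" "finite Y" and XY: "X \<inter> Y = {}"
    and disj: "disjoint_family_on SA (X \<union> Y)" "disjoint_family_on SB (X \<union> Y)"
    and sub: "\<And>f. f \<in> X \<union> Y \<Longrightarrow> SA f \<subseteq> {..<a} \<and> SB f \<subseteq> {..<b} \<and> SA f \<union> SB f \<noteq> {}"
    and adj: "\<And>f g. f \<in> X \<and> g \<in> Y \<or> f \<in> Y \<and> g \<in> X \<Longrightarrow> SB f = {} \<Longrightarrow> SA g = {} \<Longrightarrow>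
       \<exists>x\<in>SA f. \<exists>y\<in>SB g. \<not> R x y"
    and c: "a + b < (c + 1) * K"
    and a: "a + r + c < card X" "card X \<le> card Y"
    and b: "b + 2 * r + c < card X + card Y"
  shows False
proof -
  \<comment> \<open>Every index is in \<open>Big\<close>, or in \<open>\<alpha>\<close> or
    \<open>\<beta>\<close> of its class, or has non-empty traces on both cliques.\<close>
  define Big where "Big = {f \<in> X \<union> Y. K < card (SA f) + card (SB f)}"
  define \<alpha> where "\<alpha> = (\<lambda>W. {f \<in> W. SB f = {} \<and> card (SA f) \<le> K})"
  define \<beta> where "\<beta> = (\<lambda>W. {f \<in> W. SA f = {} \<and> card (SB f) \<le> K})"
  have finS: "finite (SA f)" "finite (SB f)" if "f \<in> X \<union> Y" for f
    using sub[OF that] finite_subset by blast+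
  \<comment> \<open>The traces on each clique are disjoint, so all sizes add up to at most
    \<open>a + b < (c + 1) * K\<close>.\<close>
  have Big: "card Big \<le> c"
  proof -
    have "card Big * K = (\<Sum>f\<in>Big. K)"
      by simp
    also have "\<dots> \<le> (\<Sum>f\<in>Big. card (SA f) + card (SB f))"
      by (intro sum_mono) (auto simp: Big_def)
    also have "\<dots> \<le> (\<Sum>f\<in>X \<union> Y. card (SA f) + card (SB f))"
      using fin by (intro sum_mono2) (auto simp: Big_def)
    also have "\<dots> = (\<Sum>f\<in>X \<union> Y. card (SA f)) + (\<Sum>f\<in>X \<union> Y. card (SB f))"
      by (rule sum.distrib)
    also have "(\<Sum>f\<in>X \<union> Y. card (SA f)) = card (\<Union>f\<in>X \<union> Y. SA f)"
      by (rule card_UN_disjoint'[symmetric]) (use fin finS disj in auto)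
    also have "(\<Sum>f\<in>X \<union> Y. card (SB f)) = card (\<Union>f\<in>X \<union> Y. SB f)"
      by (rule card_UN_disjoint'[symmetric]) (use fin finS disj in auto)
    also have "card (\<Union>f\<in>X \<union> Y. SA f) \<le> card {..<a}"
      using sub by (intro card_mono) auto
    also have "card (\<Union>f\<in>X \<union> Y. SB f) \<le> card {..<b}"
      using sub by (intro card_mono) auto
    finally have "card Big * K < (c + 1) * K"
      using c by simp
    then have "card Big < c + 1"
      by (rule mult_less_cancel2[THEN iffD1, THEN conjunct2])
    then show ?thesis
      by simp
  qed
  have finW: "finite (\<alpha> W)" "finite (\<beta> W)" if "W \<subseteq> X \<union> Y" for W
    using fin finite_subset[OF that] by (auto simp: \<alpha>_def \<beta>_def)
  \<comment> \<open>Otherwise density yields a small set of one class inside the first clique and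
    one of the other class inside the second with no edge between them, against
    \<open>adj\<close>.\<close>
  have key: "card (\<alpha> W) < r \<or> card (\<beta> W') < r" if W: "W = X \<and> W' = Y \<or> W = Y \<and> W' = X" for W W'
  proof (rule ccontr)
    assume large: "\<not> ?thesis"
    have WW: "\<alpha> W \<subseteq> X \<union> Y" "\<beta> W' \<subseteq> X \<union> Y"
      using W by (auto simp: \<alpha>_def \<beta>_def)
    have "\<exists>u\<in>\<alpha> W. \<exists>v\<in>\<beta> W'. \<forall>x\<in>SA u. \<forall>y\<in>SB v. R x y"
    proof (rule exists_dense_pair[where S = SA and T = SB and R = R and r = r and K = K
          and a = a and b = b, OF R])
      show "SA u \<subseteq> {..<a} \<and> card (SA u) \<le> K" if "u \<in> \<alpha> W" for u
        using that sub[of u] WW by (auto simp: \<alpha>_def)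
      show "SB u \<subseteq> {..<b} \<and> card (SB u) \<le> K" if "u \<in> \<beta> W'" for u
        using that sub[of u] WW by (auto simp: \<beta>_def)
      show "finite (\<alpha> W)" "finite (\<beta> W')"
        using W finW by auto
      show "disjoint_family_on SA (\<alpha> W)"
        using WW(1) disj(1) by (rule disjoint_family_on_mono)
      show "disjoint_family_on SB (\<beta> W')"
        using WW(2) disj(2) by (rule disjoint_family_on_mono)
      show "r \<le> card (\<alpha> W)" "r \<le> card (\<beta> W')"
        using large by simp_all
    qed
    then obtain u v where uv: "u \<in> \<alpha> W" "v \<in> \<beta> W'" "\<forall>x\<in>SA u. \<forall>y\<in>SB v. R x y"
      by blast
    then have "u \<in> X \<and> v \<in> Y \<or> u \<in> Y \<and> v \<in> X"
      using W by (auto simp: \<alpha>_def \<beta>_def)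
    from adj[OF this] uv show False
      by (auto simp: \<alpha>_def \<beta>_def)
  qed
  \<comment> \<open>An index of \<open>W\<close> is big, or in \<open>\<alpha> W\<close>, or has a
    set meeting the second clique, which happens at most \<open>b\<close> times.\<close>
  have covA: "card W \<le> c + card (\<alpha> W) + b" if W: "W \<subseteq> X \<union> Y" for W
  proof -
    let ?M = "{f \<in> W. SB f \<noteq> {}}"
    have "finite W"
      using fin W by (auto intro: finite_subset)
    then have finM: "finite ?M"
      by simp
    have "card ?M \<le> b"
    proof (rule card_nonempty_disjoint_le[OF finM, of SB])
      show "disjoint_family_on SB ?M"
        by (rule disjoint_family_on_mono[OF _ disj(2)]) (use W in blast)
    qed (use sub W in blast)
    moreover have "W \<subseteq> Big \<union> \<alpha> W \<union> ?M"
      using W by (auto simp: Big_def \<alpha>_def)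
    then have "card W \<le> card (Big \<union> \<alpha> W \<union> ?M)"
      using fin finW[OF W] finM by (intro card_mono) (auto simp: Big_def)
    moreover have "card (Big \<union> \<alpha> W \<union> ?M) \<le> card Big + card (\<alpha> W) + card ?M"
      using card_Un_le[of "Big \<union> \<alpha> W" ?M] card_Un_le[of Big "\<alpha> W"] by linarith
    ultimately show ?thesis
      using Big by linarith
  qed
  have covB: "card W \<le> c + card (\<beta> W) + a" if W: "W \<subseteq> X \<union> Y" for W
  proof -
    let ?M = "{f \<in> W. SA f \<noteq> {}}"
    have "finite W"
      using fin W by (auto intro: finite_subset)
    then have finM: "finite ?M"
      by simp
    have "card ?M \<le> a"
    proof (rule card_nonempty_disjoint_le[OF finM, of SA])
      show "disjoint_family_on SA ?M"
        by (rule disjoint_family_on_mono[OF _ disj(1)]) (use W in blast)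
    qed (use sub W in blast)
    moreover have "W \<subseteq> Big \<union> \<beta> W \<union> ?M"
      using W by (auto simp: Big_def \<beta>_def)
    then have "card W \<le> card (Big \<union> \<beta> W \<union> ?M)"
      using fin finW[OF W] finM by (intro card_mono) (auto simp: Big_def)
    moreover have "card (Big \<union> \<beta> W \<union> ?M) \<le> card Big + card (\<beta> W) + card ?M"
      using card_Un_le[of "Big \<union> \<beta> W" ?M] card_Un_le[of Big "\<beta> W"] by linarith
    ultimately show ?thesis
      using Big by linarith
  qed
  \<comment> \<open>Both classes have more than \<open>a + r + c\<close> members, so each has at
    least \<open>r\<close> small sets missing the first clique. By \<open>key\<close> both
    \<open>\<alpha>\<close> sets are then small, so all but fewer than \<open>2 * r + c\<close> of
    the branch sets meet the second clique, which has too few vertices.\<close>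
  have "\<not> card (\<beta> Y) < r" "\<not> card (\<beta> X) < r"
    using covB[of X] covB[of Y] a by auto
  then have "card (\<alpha> X) < r" "card (\<alpha> Y) < r"
    using key by blast+
  moreover have "card (\<alpha> (X \<union> Y)) \<le> card (\<alpha> X) + card (\<alpha> Y)"
    using card_Un_le[of "\<alpha> X" "\<alpha> Y"] by (simp add: \<alpha>_def conj_disj_distribR Collect_disj_eq)
  moreover have "card (X \<union> Y) = card X + card Y"
    using fin XY by (simp add: card_Un_disjoint)
  ultimately show False
    using covA[OF order_refl] b by linarith
qed

section \<open>Gluing copies along a clique\<close>

lemma list_colorable_mono: "list_colorable G k \<Longrightarrow> k \<le> k' \<Longrightarrow> list_colorable G k'"
  unfolding list_colorable_def by (intro allI impI, drule spec, erule mp) auto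

lemma (in pair_graph) less_list_chromatic_number:
  assumes "\<not> list_colorable G k"
  shows "k < list_chromatic_number G"
  using assms list_chromatic_number_attained list_colorable_mono by (meson not_less)

text \<open>Used with \<open>p\<close> the page number, to see that a connected set avoiding the
  shared clique stays in one copy.\<close>

lemma connected_induce_const:
  assumes conn: "Digraph_Component.connected (with_proj G \<restriction> Z)"
    and const: "\<And>u v. u \<in> Z \<Longrightarrow> v \<in> Z \<Longrightarrow> (u, v) \<in> parcs G \<Longrightarrow> p u = p v"
    and uv: "u \<in> Z" "v \<in> Z"
  shows "p u = p v"
proof -
  let ?H = "mk_symmetric (with_proj G \<restriction> Z)"
  have "(u, v) \<in> rtrancl_on Z (parcs ?H)"
    using conn uv unfolding connected_def strongly_connected_def reachable_def
    by simp
  then show ?thesis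
    by (induction rule: rtrancl_on_induct) (auto simp: parcs_mk_symmetric const)
qed

text \<open>
  The vertex \<open>prod_encode (i, x)\<close> is the \<open>x\<close>-th vertex of the shared clique if \<open>i = 0\<close>, and the
  \<open>x\<close>-th vertex of the \<open>i\<close>-th copy of the second clique otherwise; \<open>R\<close> is the relation of
  non-adjacency between the shared clique and each copy.
\<close>

definition book_adj :: "(nat \<Rightarrow> nat \<Rightarrow> bool) \<Rightarrow> nat \<times> nat \<Rightarrow> nat \<times> nat \<Rightarrow> bool" where
  "book_adj R u v \<longleftrightarrow> u \<noteq> v \<and>
     (if fst u = 0 then fst v = 0 \<or> \<not> R (snd u) (snd v)
      else if fst v = 0 then \<not> R (snd v) (snd u) else fst u = fst v)"

definition book_verts :: "nat \<Rightarrow> nat \<Rightarrow> nat \<Rightarrow> (nat \<times> nat) set" where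
  "book_verts a b m = {0} \<times> {..<a} \<union> {1..m} \<times> {..<b}"

text \<open>The pairs are coded by numbers because the theorem asks for vertices of type
  \<open>nat\<close>.\<close>

definition book :: "nat \<Rightarrow> nat \<Rightarrow> nat \<Rightarrow> (nat \<Rightarrow> nat \<Rightarrow> bool) \<Rightarrow> nat pair_pre_digraph" where
  "book a b m R = \<lparr>pverts = {v. prod_decode v \<in> book_verts a b m},
     parcs = {(v, w). prod_decode v \<in> book_verts a b m \<and> prod_decode w \<in> book_verts a b m \<and>
       book_adj R (prod_decode v) (prod_decode w)}\<rparr>"

lemma prod_encode_in_book:
  "prod_encode u \<in> pverts (book a b m R) \<longleftrightarrow> u \<in> book_verts a b m"
  "(prod_encode u, prod_encode v) \<in> parcs (book a b m R) \<longleftrightarrow>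
     u \<in> book_verts a b m \<and> v \<in> book_verts a b m \<and> book_adj R u v"
  by (simp_all add: book_def)

lemma book_adj_sym: "book_adj R u v \<Longrightarrow> book_adj R v u"
  by (auto simp: book_adj_def split: if_splits)

lemma pair_graph_book: "pair_graph (book a b m R)"
proof
  have "finite (prod_decode -` book_verts a b m)"
    by (rule finite_vimageI) (auto simp: book_verts_def inj_prod_decode)
  then show fin: "finite (pverts (book a b m R))"
    by (simp add: book_def vimage_def)
  show "finite (parcs (book a b m R))"
    by (rule finite_subset[OF _ finite_cartesian_product[OF fin fin]]) (auto simp: book_def)
  show "fst e \<in> pverts (book a b m R)" "snd e \<in> pverts (book a b m R)" "fst e \<noteq> snd e"
    if "e \<in> parcs (book a b m R)" for e
    using that by (auto simp: book_def book_adj_def)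
  show "symmetric (with_proj (book a b m R))"
    by (auto simp: symmetric_def book_def intro!: symI dest: book_adj_sym)
qed

text \<open>Only \<open>a + b - 1\<close> colours occur in the lists. The hypothesis on
  \<open>k\<close> keeps every list large enough after deletion, while the copy made for the actual
  colouring of the shared clique would need \<open>a + b\<close> distinct colours.\<close>

lemma not_list_colorable_book:
  assumes k: "\<And>y. y < b \<Longrightarrow> k + card {x. x < a \<and> R x y} < a + b"
    and ab: "0 < b"
  shows "\<exists>m. \<not> list_colorable (book a b m R) k"
proof -
  define n where "n = a + b - 1"
  have "finite ({..<a} \<rightarrow>\<^sub>E {..<n})"
    by (intro finite_PiE) auto
  \<comment> \<open>One copy per colouring of the shared clique; page 0 being that clique,
    \<open>e i\<close> belongs to page \<open>Suc i\<close>.\<close>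
  then obtain m :: nat and e where e: "{..<a} \<rightarrow>\<^sub>E {..<n} = e ` {i. i < m}"
    by (elim finite_imp_nat_seg_image_inj_on[THEN exE] exE conjE)
  define l where "l = (\<lambda>(i, y). if i = 0 then {..<n} else {..<n} - e (i - 1) ` {x. x < a \<and> R x y})"
  have n: "a + b = Suc n"
    using ab by (simp add: n_def)
  have "\<not> list_colorable (book a b m R) k"
  proof
    assume *: "list_colorable (book a b m R) k"
    have "finite (l (prod_decode v)) \<and> k \<le> card (l (prod_decode v))"
      if "v \<in> pverts (book a b m R)" for v
    proof -
      obtain i y where v: "v = prod_encode (i, y)"
        by (metis prod_decode_inverse surj_pair)
      have kn: "k \<le> n"
        using k[OF ab] n by simp
      show ?thesis
      proof (cases "i = 0")
        case True
        then show ?thesis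
          using kn by (simp add: v l_def)
      next
        case False
        then have y: "y < b"
          using that by (simp add: v prod_encode_in_book book_verts_def)
        let ?F = "e (i - 1) ` {x. x < a \<and> R x y}"
        have "card ?F \<le> card {x. x < a \<and> R x y}"
          by (rule card_image_le) simp
        moreover have "n - card ?F \<le> card ({..<n} - ?F)"
          using diff_card_le_card_Diff[of ?F "{..<n}"] by simp
        ultimately have "k \<le> card ({..<n} - ?F)"
          using k[OF y] n by linarith
        then show ?thesis
          using False by (simp add: v l_def)
      qed
    qed
    then have "\<exists>c. proper_coloring (book a b m R) c \<and>
        (\<forall>v\<in>pverts (book a b m R). c v \<in> l (prod_decode v))"
      using *[unfolded list_colorable_def, THEN spec, of "\<lambda>v. l (prod_decode v)"] by simp
    then obtain c where c: "proper_coloring (book a b m R) c"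
      and cl: "\<And>v. v \<in> pverts (book a b m R) \<Longrightarrow> c v \<in> l (prod_decode v)"
      by blast
    define d where "d = (\<lambda>u. c (prod_encode u))"
    have d: "d u \<noteq> d v" if "u \<in> book_verts a b m" "v \<in> book_verts a b m" "book_adj R u v" for u v
    proof -
      have "(prod_encode u, prod_encode v) \<in> parcs (book a b m R)"
        using that by (simp add: prod_encode_in_book)
      then show ?thesis
        using c unfolding proper_coloring_def d_def by fast
    qed
    have dl: "d u \<in> l u" if "u \<in> book_verts a b m" for u
      using cl[of "prod_encode u"] that by (simp add: d_def prod_encode_in_book)
    have "(\<lambda>x\<in>{..<a}. d (0, x)) \<in> {..<a} \<rightarrow>\<^sub>E {..<n}"
      using dl[of "(0, _)"] by (simp add: book_verts_def l_def)
    then obtain i where i: "i < m" "(\<lambda>x\<in>{..<a}. d (0, x)) = e i"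
      unfolding e by (elim imageE) simp
    have ei: "e i x = d (0, x)" if "x < a" for x
      using fun_cong[OF i(2), of x] that by simp
    let ?W = "{0} \<times> {..<a} \<union> {Suc i} \<times> {..<b}"
    have W: "?W \<subseteq> book_verts a b m"
      using i(1) by (auto simp: book_verts_def)
    \<comment> \<open>Non-adjacent pairs differ because the colour of \<open>x\<close> was deleted
      from the list of \<open>y\<close>; adjacent pairs differ by properness.\<close>
    have cross: "d (0, x) \<noteq> d (Suc i, y)" if "x < a" "y < b" for x y
    proof (cases "R x y")
      case True
      have "d (Suc i, y) \<in> l (Suc i, y)"
        using W that by (intro dl) auto
      then have "d (Suc i, y) \<notin> e i ` {x. x < a \<and> R x y}"
        by (simp add: l_def)
      moreover have "e i x \<in> e i ` {x. x < a \<and> R x y}"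
        using True that(1) by blast
      ultimately show ?thesis
        using ei[OF that(1)] by metis
    next
      case False
      then show ?thesis
        using W that by (intro d) (auto simp: book_adj_def)
    qed
    have "inj_on d ?W"
    proof (rule inj_onI, rule ccontr)
      fix u v assume uv: "u \<in> ?W" "v \<in> ?W" "d u = d v" "u \<noteq> v"
      show False
      proof (cases "fst u = fst v")
        case True
        then have "book_adj R u v"
          using uv(4) by (simp add: book_adj_def)
        then show False
          using d uv W by blast
      next
        case False
        then show False
          using uv cross by fastforce
      qed
    qed
    moreover have "d ` ?W \<subseteq> {..<n}"
    proof (rule image_subsetI)
      fix u assume "u \<in> ?W"
      then have "d u \<in> l u"
        using dl W by blast
      then show "d u \<in> {..<n}"
        by (auto simp: l_def split: if_splits prod.splits)
    qed
    ultimately have "card ?W \<le> card {..<n}"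
      by (intro card_inj_on_le) auto
    moreover have "card ?W = a + b"
      by (subst card_Un_disjoint) (auto simp: card_cartesian_product)
    ultimately show False
      using n by simp
  qed
  then show ?thesis ..
qed

text \<open>As \<open>a < s \<le> t\<close>, both classes have a branch set avoiding the shared
  clique. All such sets lie in a single copy, so the traces on that copy and on the shared clique
  contradict \<open>no_bipartite_model_in_two_cliques\<close>.\<close>

lemma not_has_minor_book:
  assumes R: "dense_on_families r K a b R"
    and c: "a + b < (c + 1) * K"
    and a: "a + r + c < s" "s \<le> t"
    and b: "b + 2 * r + c < s + t"
  shows "\<not> has_minor (book a b m R) (complete_bipartite s t)"
proof
  let ?G = "book a b m R"
  define X :: "(nat + nat) set" where "X = Inl ` {..<s}"
  define Y :: "(nat + nat) set" where "Y = Inr ` {..<t}"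
  assume "has_minor ?G (complete_bipartite s t)"
  moreover have "pverts (complete_bipartite s t) = X \<union> Y"
    by (simp add: complete_bipartite_def X_def Y_def Plus_def)
  moreover have "parcs (complete_bipartite s t) = X \<times> Y \<union> Y \<times> X"
    by (simp add: complete_bipartite_def X_def Y_def)
  ultimately obtain Z where
    *: "(\<forall>f\<in>X \<union> Y. Z f \<noteq> {} \<and> Z f \<subseteq> pverts ?G \<and>
          Digraph_Component.connected (with_proj ?G \<restriction> Z f)) \<and>
        (\<forall>f\<in>X \<union> Y. \<forall>g\<in>X \<union> Y. f \<noteq> g \<longrightarrow> Z f \<inter> Z g = {}) \<and>
        (\<forall>(f, g)\<in>X \<times> Y \<union> Y \<times> X. \<exists>u\<in>Z f. \<exists>v\<in>Z g. (u, v) \<in> parcs ?G)"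
    unfolding has_minor_def by (elim exE) simp
  have Z: "Z f \<noteq> {} \<and> Z f \<subseteq> pverts ?G \<and>
      Digraph_Component.connected (with_proj ?G \<restriction> Z f)" if "f \<in> X \<union> Y" for f
    using * that by blast
  have Zdisj: "Z f \<inter> Z g = {}" if "f \<in> X \<union> Y" "g \<in> X \<union> Y" "f \<noteq> g" for f g
    using * that by blast
  have Zadj: "\<exists>u\<in>Z f. \<exists>v\<in>Z g. (u, v) \<in> parcs ?G" if "f \<in> X \<and> g \<in> Y \<or> f \<in> Y \<and> g \<in> X" for f g
  proof -
    have "(f, g) \<in> X \<times> Y \<union> Y \<times> X"
      using that by blast
    from bspec[OF *[THEN conjunct2, THEN conjunct2] this] show ?thesis
      by simp
  qed
  have cardXY: "card X = s" "card Y = t"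
    by (simp_all add: X_def Y_def card_image)
  have finXY: "finite X" "finite Y" and XY: "X \<inter> Y = {}"
    by (auto simp: X_def Y_def)
  define page where "page = (\<lambda>v. fst (prod_decode v))"
  define tr where "tr = (\<lambda>i n f. {x. x < (n::nat) \<and> prod_encode (i, x) \<in> Z f})"
  have tr_disj: "disjoint_family_on (tr i n) (X \<union> Y)" for i n
    using Zdisj unfolding disjoint_family_on_def tr_def by blast
  have tr_sub: "tr i n f \<subseteq> {..<n}" for i n f
    by (auto simp: tr_def)
  have in_tr: "snd (prod_decode v) \<in> tr j (if j = 0 then a else b) f"
    if "v \<in> Z f" "page v = j" "f \<in> X \<union> Y" for f v j
  proof -
    have "v = prod_encode (j, snd (prod_decode v))"
      using that(2) by (metis page_def prod.collapse prod_decode_inverse)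
    moreover have "v \<in> pverts ?G"
      using Z[OF that(3)] that(1) by blast
    then have "snd (prod_decode v) < (if j = 0 then a else b)"
      using that(2) by (auto simp: book_def book_verts_def page_def)
    ultimately show ?thesis
      using that(1) by (simp add: tr_def)
  qed
  have page_pos: "page v \<noteq> 0" if "tr 0 a f = {}" "f \<in> X \<union> Y" "v \<in> Z f" for f v
    using in_tr[OF that(3) _ that(2), of 0] that(1) by auto
  have page_adj: "page u = page v" if "(u, v) \<in> parcs ?G" "page u \<noteq> 0" "page v \<noteq> 0" for u v
    using that by (simp add: book_def page_def book_adj_def)
  have page_const: "page u = page v" if "tr 0 a f = {}" "f \<in> X \<union> Y" "u \<in> Z f" "v \<in> Z f" for f u v
  proof (rule connected_induce_const[of ?G "Z f" page])
    show "page v = page w" if "v \<in> Z f" "w \<in> Z f" "(v, w) \<in> parcs ?G" for v w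
      using page_adj[OF that(3)] page_pos[OF \<open>tr 0 a f = {}\<close> \<open>f \<in> X \<union> Y\<close>] that(1,2) by blast
  qed (use Z[OF that(2)] that(3,4) in blast)+
  have page_eq: "page u = page v"
    if "f \<in> X \<and> g \<in> Y \<or> f \<in> Y \<and> g \<in> X" "tr 0 a f = {}" "tr 0 a g = {}" "u \<in> Z f" "v \<in> Z g" for f g u v
  proof -
    have fg: "f \<in> X \<union> Y" "g \<in> X \<union> Y"
      using that(1) by auto
    from Zadj[OF that(1)] obtain u' v'
      where uv: "u' \<in> Z f" "v' \<in> Z g" "(u', v') \<in> parcs ?G"
      by blast
    have "page u' = page v'"
      using page_adj[OF uv(3)] page_pos that(2,3) fg uv(1,2) by blast
    then show ?thesis
      using page_const[OF that(2) fg(1) that(4) uv(1)] page_const[OF that(3) fg(2) that(5) uv(2)]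
      by simp
  qed
  have avoid: "\<exists>f\<in>W. tr 0 a f = {}" if "W \<subseteq> X \<union> Y" "a < card W" for W
  proof (rule ccontr)
    assume none: "\<not> ?thesis"
    have "card W \<le> a"
    proof (rule card_nonempty_disjoint_le)
      show "finite W"
        using finite_subset[OF that(1)] finXY by simp
      show "disjoint_family_on (tr 0 a) W"
        using that(1) tr_disj by (rule disjoint_family_on_mono)
    qed (use none tr_sub in blast)
    with that(2) show False
      by simp
  qed
  obtain f0 where f0: "f0 \<in> X" "tr 0 a f0 = {}"
    using avoid[of X] a cardXY by auto
  obtain g0 where g0: "g0 \<in> Y" "tr 0 a g0 = {}"
    using avoid[of Y] a cardXY by auto
  obtain u0 v0 where u0: "u0 \<in> Z f0" and v0: "v0 \<in> Z g0"
    using Z[of f0] Z[of g0] f0 g0 by blast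
  define i where "i = page u0"
  have i: "i \<noteq> 0"
    unfolding i_def using page_pos[OF f0(2) _ u0] f0(1) by blast
  \<comment> \<open>Sets of \<open>Y\<close> are compared with \<open>f0\<close> and sets of
    \<open>X\<close> with \<open>g0\<close>, since the model guarantees edges only between opposite
    classes.\<close>
  have page_i: "page v = i" if f: "f \<in> X \<union> Y" "tr 0 a f = {}" "v \<in> Z f" for f v
  proof (cases "f \<in> Y")
    case True
    then show ?thesis
      using page_eq[of f0 f u0 v] f0 u0 f by (simp add: i_def)
  next
    case False
    then have "f \<in> X"
      using f by simp
    then show ?thesis
      using page_eq[of f g0 v v0] page_eq[of f0 g0 u0 v0] f0 u0 g0 v0 f by (simp add: i_def)
  qed
  show False
  proof (rule no_bipartite_model_in_two_cliques[where SA = "tr 0 a" and SB = "tr i b" and X = X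
        and Y = Y and a = a and b = b and r = r and K = K and R = R and c = c, OF R finXY XY])
    show "tr 0 a f \<subseteq> {..<a} \<and> tr i b f \<subseteq> {..<b} \<and> tr 0 a f \<union> tr i b f \<noteq> {}"
      if "f \<in> X \<union> Y" for f
    proof -
      obtain v where v: "v \<in> Z f"
        using Z[OF \<open>f \<in> X \<union> Y\<close>] by blast
      have "tr 0 a f \<union> tr i b f \<noteq> {}"
        using page_i[OF that _ v] in_tr[OF v _ that, of i] i by auto
      then show ?thesis
        using tr_sub by simp
    qed
    show "\<exists>x\<in>tr 0 a f. \<exists>y\<in>tr i b g. \<not> R x y"
      if fg: "f \<in> X \<and> g \<in> Y \<or> f \<in> Y \<and> g \<in> X" "tr i b f = {}" "tr 0 a g = {}" for f g
    proof -
      have fg': "f \<in> X \<union> Y" "g \<in> X \<union> Y"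
        using fg(1) by auto
      obtain u v where uv: "u \<in> Z f" "v \<in> Z g" "(u, v) \<in> parcs ?G"
        using Zadj[OF fg(1)] by blast
      have v: "page v = i"
        using page_i[OF fg'(2) fg(3) uv(2)] .
      \<comment> \<open>A neighbour of a vertex in copy \<open>i\<close> lies in copy
        \<open>i\<close> or in the shared clique, and \<open>Z f\<close> has no vertex in copy
        \<open>i\<close>.\<close>
      have u: "page u = 0"
      proof (rule ccontr)
        assume "page u \<noteq> 0"
        then have "page u = i"
          using page_adj[OF uv(3)] v i by simp
        then show False
          using in_tr[OF uv(1) _ fg'(1), of i] fg(2) i by simp
      qed
      have "\<not> R (snd (prod_decode u)) (snd (prod_decode v))"
        using uv(3) u v i by (simp add: book_def book_adj_def page_def)
      then show ?thesis
        using in_tr[OF uv(1) u fg'(1)] in_tr[OF uv(2) v fg'(2)] i by auto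
    qed
  qed (use c a b cardXY tr_disj in simp_all)
qed

section \<open>Choice of the parameters\<close>

text \<open>The first two factors are at most \<open>exp\<close> of a multiple of
  \<open>s * ln s\<close> plus a multiple of \<open>s\<close>, while
  \<open>(1 - \<theta>) ^ (r * r) \<le> exp (- \<theta> * r * r)\<close> with \<open>r\<close>
  linear in \<open>s\<close>, so the quadratic exponent wins.\<close>

lemma eventually_union_bound_less_1:
  fixes C \<theta> :: real and D q :: nat
  assumes "C \<ge> 1" "0 < D" "0 < q" "0 < \<theta>" "\<theta> \<le> 1"
  shows "\<forall>\<^sub>F s :: nat in sequentially. \<forall>a b. real (a + b) \<le> (C + 2) * real s \<longrightarrow>
           real (Suc (s div D div 4)) ^ (a + b) * real q ^ b
             * (1 - \<theta>) ^ ((s div D div 4) * (s div D div 4)) < 1"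
proof -
  define A \<delta> B where "A = C + 2" and "\<delta> = 1 / (4 * real D)" and "B = ln (real q)"
  have pos: "A > 0" "\<delta> > 0"
    using assms by (auto simp: A_def \<delta>_def)
  have "\<forall>\<^sub>F s :: nat in sequentially. A * real s * (ln (real s) + B) < \<theta> * (\<delta> * real s - 2)\<^sup>2"
    using pos \<open>0 < \<theta>\<close> by real_asymp
  then show ?thesis
    using eventually_ge_at_top[of "8 * D + 4"]
  proof eventually_elim
    case (elim s)
    define r where "r = s div D div 4"
    have q: "1 \<le> real q"
      using \<open>0 < q\<close> by simp
    have r: "\<delta> * real s - 2 \<le> real r"
    proof -
      have "s < D * (s div D + 1)"
        using \<open>0 < D\<close> by (simp add: dividend_less_times_div)
      also have "\<dots> \<le> D * (4 * (r + 1))"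
        by (intro mult_left_mono) (auto simp: r_def)
      finally have "real s < real (D * (4 * (r + 1)))"
        by (rule of_nat_less_iff[THEN iffD2])
      then have "\<delta> * real s \<le> real r + 1"
        using \<open>0 < D\<close> by (simp add: \<delta>_def field_simps)
      then show ?thesis by simp
    qed
    \<comment> \<open>Non-negativity allows squaring the lower bound on \<open>r\<close>; this is
      where \<open>8 * D\<close> comes from.\<close>
    have r2: "0 \<le> \<delta> * real s - 2"
    proof -
      have "real (8 * D) \<le> real s"
        using elim(2) by (intro of_nat_mono) simp
      then show ?thesis
        using \<open>0 < D\<close> by (simp add: \<delta>_def field_simps)
    qed
    have rs: "real (Suc r) \<le> real s"
    proof -
      have "r \<le> s div 4"
        unfolding r_def by (intro div_le_mono) simp
      then show ?thesis
        using elim(2) by simp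
    qed
    show ?case
    proof (intro allI impI)
      fix a b :: nat assume ab: "real (a + b) \<le> (C + 2) * real s"
      have "real (Suc r) ^ (a + b) = exp (real (a + b) * ln (real (Suc r)))"
        by (simp only: exp_of_nat_mult exp_ln of_nat_0_less_iff zero_less_Suc)
      also have "\<dots> \<le> exp (A * real s * ln (real s))"
        unfolding exp_le_cancel_iff using ab rs elim(2)
        by (intro mult_mono) (auto simp: A_def)
      finally have 1: "real (Suc r) ^ (a + b) \<le> exp (A * real s * ln (real s))" .
      have "real q ^ b = exp (real b * B)"
        using q by (simp add: exp_of_nat_mult B_def)
      also have "\<dots> \<le> exp (A * real s * B)"
        unfolding exp_le_cancel_iff using ab q
        by (intro mult_right_mono) (auto simp: A_def B_def)
      finally have 2: "real q ^ b \<le> exp (A * real s * B)" .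
      have "(1 - \<theta>) ^ (r * r) \<le> exp (- \<theta>) ^ (r * r)"
        using exp_ge_add_one_self[of "- \<theta>"] assms by (intro power_mono) auto
      also have "\<dots> = exp (- (\<theta> * (real r)\<^sup>2))"
        by (simp add: exp_of_nat_mult[symmetric] power2_eq_square algebra_simps)
      also have "\<dots> \<le> exp (- (\<theta> * (\<delta> * real s - 2)\<^sup>2))"
        using power_mono[OF r r2, of 2] assms by simp
      finally have 3: "(1 - \<theta>) ^ (r * r) \<le> exp (- (\<theta> * (\<delta> * real s - 2)\<^sup>2))" .
      have "real (Suc r) ^ (a + b) * real q ^ b * (1 - \<theta>) ^ (r * r)
          \<le> exp (A * real s * ln (real s)) * exp (A * real s * B) * exp (- (\<theta> * (\<delta> * real s - 2)\<^sup>2))"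
        using 1 2 3 assms by (intro mult_mono) auto
      also have "\<dots> = exp (A * real s * (ln (real s) + B) - \<theta> * (\<delta> * real s - 2)\<^sup>2)"
        by (simp add: exp_add[symmetric] algebra_simps)
      also have "\<dots> < 1"
        using elim(1) by simp
      finally show "real (Suc (s div D div 4)) ^ (a + b) * real q ^ b
             * (1 - \<theta>) ^ ((s div D div 4) * (s div D div 4)) < 1"
        by (simp only: r_def)
    qed
  qed
qed

theorem theorem1:
  fixes \<epsilon> C :: real
  assumes "\<epsilon> > 0" and "C \<ge> 1"
  shows "\<exists>N :: nat. \<forall>s t :: nat. N \<le> s \<and> s \<le> t \<and> real t \<le> C * real s \<longrightarrow>
           (\<exists>G :: nat pair_pre_digraph. pair_graph G \<and>
              \<not> has_minor G (complete_bipartite s t) \<and>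
              real (list_chromatic_number G) > (1 - \<epsilon>) * (2 * real s + real t))"
proof -
  \<comment> \<open>\<open>D\<close> is both the number of values of the random function and the
    fraction \<open>1 / D\<close> given up in clique sizes and list sizes. \<open>K\<close> makes
    \<open>a + b < (r + 1) * K\<close>, so at most \<open>r\<close> branch sets are big.\<close>
  define D where "D = nat \<lceil>2 / \<epsilon>\<rceil> + 2"
  define K where "K = nat \<lceil>4 * real D * (C + 2)\<rceil>"
  define \<theta> where "\<theta> = 1 / real D ^ (K * K)"
  have D: "2 \<le> D" "2 \<le> \<epsilon> * real D"
  proof -
    have "2 / \<epsilon> \<le> real D"
      unfolding D_def by linarith
    then show "2 \<le> \<epsilon> * real D"
      using assms by (simp add: field_simps)
  qed (simp add: D_def)
  have K: "4 * real D * (C + 2) \<le> real K"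
    unfolding K_def by linarith
  have "1 \<le> real D ^ (K * K)"
    using D by simp
  then have \<theta>: "0 < \<theta>" "\<theta> \<le> 1"
    using D by (auto simp: \<theta>_def)
  have "\<forall>\<^sub>F s :: nat in sequentially. D \<le> s \<and> (\<forall>a b. real (a + b) \<le> (C + 2) * real s \<longrightarrow>
           real (Suc (s div D div 4)) ^ (a + b) * real D ^ b
             * (1 - \<theta>) ^ ((s div D div 4) * (s div D div 4)) < 1)"
    using eventually_conj[OF eventually_ge_at_top eventually_union_bound_less_1] assms D \<theta> by auto
  then obtain N where N: "\<And>s. N \<le> s \<Longrightarrow> D \<le> s \<and> (\<forall>a b. real (a + b) \<le> (C + 2) * real s \<longrightarrow>
           real (Suc (s div D div 4)) ^ (a + b) * real D ^ b
             * (1 - \<theta>) ^ ((s div D div 4) * (s div D div 4)) < 1)"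
    unfolding eventually_sequentially by blast
  show ?thesis
  proof (intro exI[of _ N] allI impI, elim conjE)
    fix s t :: nat assume st: "N \<le> s" "s \<le> t" "real t \<le> C * real s"
    \<comment> \<open>The cliques fall short of \<open>s\<close> and \<open>s + t\<close> by
      \<open>m\<close>; with \<open>r = m div 4\<close> and \<open>m \<ge> 1\<close> this shortfall
      exceeds the \<open>3 * r\<close> exceptional branch sets.\<close>
    define m r a b where "m = s div D" and "r = m div 4" and "a = s - m" and "b = s + t - m"
    have s: "D \<le> s"
      using N[OF st(1)] by blast
    have "1 \<le> s div D"
      using s D by (simp add: div_greater_zero_iff Suc_leI)
    then have m: "1 \<le> m" "2 * m \<le> s"
      using D div_le_mono2[of 2 D s] by (auto simp: m_def)
    have mD: "real m * real D \<le> real s" "real s < real D * (real m + 1)"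
    proof -
      show "real m * real D \<le> real s"
        unfolding m_def of_nat_mult[symmetric] by (rule of_nat_mono) simp
      have "s < D * (m + 1)"
        using D by (simp add: m_def dividend_less_times_div)
      then have "real s < real (D * (m + 1))"
        by (rule of_nat_less_iff[THEN iffD2])
      then show "real s < real D * (real m + 1)"
        by (simp add: algebra_simps)
    qed
    have ab: "real (a + b) \<le> (C + 2) * real s"
    proof -
      have "real (a + b) \<le> 2 * real s + real t"
        by (simp add: a_def b_def)
      with st(3) show ?thesis
        by (simp add: algebra_simps)
    qed
    have "real (Suc r) ^ (a + b) * real D ^ b * (1 - 1 / real D ^ (K * K)) ^ (r * r) < 1"
      using N[OF st(1)] ab unfolding r_def m_def \<theta>_def by blast
    then obtain R where deg: "\<And>y. y < b \<Longrightarrow> D * card {x. x < a \<and> R x y} \<le> a"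
      and R: "dense_on_families r K a b R"
      using D by (elim exists_sparse_relation[rotated]) auto
    have D0: "0 < D"
      using D by simp
    \<comment> \<open>Each vertex of a copy loses at most \<open>a div D\<close> of the
      \<open>a + b - 1\<close> colours.\<close>
    define k where "k = a + b - 1 - a div D"
    have aD: "a div D \<le> a" "1 \<le> b"
      using m st by (auto simp: a_def b_def)
    have "k + card {x. x < a \<and> R x y} < a + b" if "y < b" for y
    proof -
      have "card {x. x < a \<and> R x y} \<le> a div D"
        using deg[OF that] D0 by (simp add: less_eq_div_iff_mult_less_eq mult.commute)
      then show ?thesis
        using aD unfolding k_def by linarith
    qed
    then obtain p where p: "\<not> list_colorable (book a b p R) k"
      using not_list_colorable_book aD(2) by (metis less_eq_Suc_le One_nat_def)
    have "\<not> has_minor (book a b p R) (complete_bipartite s t)"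
    proof (rule not_has_minor_book[OF R, where c = r])
      have "real s < real (4 * D * (r + 1))"
      proof -
        have "real m + 1 \<le> 4 * (real r + 1)"
        proof -
          have "m + 1 \<le> 4 * (r + 1)"
            unfolding r_def by presburger
          then have "real (m + 1) \<le> real (4 * (r + 1))"
            by (rule of_nat_mono)
          then show ?thesis
            by simp
        qed
        then have "real D * (real m + 1) \<le> real D * (4 * (real r + 1))"
          by (intro mult_left_mono) auto
        with mD(2) show ?thesis
          by (simp add: algebra_simps)
      qed
      then have "(C + 2) * real s < (C + 2) * real (4 * D * (r + 1))"
        using assms by (intro mult_strict_left_mono) auto
      also have "\<dots> = (4 * real D * (C + 2)) * real (r + 1)"
        by (simp add: algebra_simps)
      also have "\<dots> \<le> real K * real (r + 1)"
        using K by (intro mult_right_mono) auto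
      finally have "real (a + b) < real ((r + 1) * K)"
        using ab by (simp add: algebra_simps)
      then show "a + b < (r + 1) * K"
        by (rule of_nat_less_iff[THEN iffD1])
      show "a + r + r < s" "b + 2 * r + r < s + t" "s \<le> t"
        using m st(2) by (auto simp: a_def b_def r_def)
    qed
    moreover have "(1 - \<epsilon>) * (2 * real s + real t) < real (list_chromatic_number (book a b p R))"
    proof -
      have "k < list_chromatic_number (book a b p R)"
        using pair_graph.less_list_chromatic_number[OF pair_graph_book p] .
      then have "a + b \<le> a div D + list_chromatic_number (book a b p R)"
        unfolding k_def by linarith
      then have 1: "real a + real b \<le> real (a div D) + real (list_chromatic_number (book a b p R))"
        by (metis of_nat_add of_nat_le_iff)
      have 2: "real a + real b = 2 * real s + real t - 2 * real m"
        using m st by (simp add: a_def b_def of_nat_diff)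
      have "a div D \<le> m"
        unfolding m_def a_def by (intro div_le_mono) simp
      then have 3: "real (a div D) \<le> real m"
        by simp
      \<comment> \<open>The total loss: \<open>m\<close> from each clique size and at most
        \<open>m\<close> from the deleted colours.\<close>
      have "3 * real m < \<epsilon> * (2 * real s + real t)"
      proof -
        have "2 * real m \<le> \<epsilon> * real D * real m"
          using D by (intro mult_right_mono) auto
        also have "\<dots> = \<epsilon> * (real m * real D)"
          by simp
        also have "\<dots> \<le> \<epsilon> * real s"
          using mD(1) assms by (intro mult_left_mono) auto
        finally have "2 * real m \<le> \<epsilon> * real s" .
        moreover have "\<epsilon> * real s \<le> \<epsilon> * real t"
          using st(2) assms by (intro mult_left_mono) auto
        moreover have "0 < real m"
          using m by simp
        ultimately show ?thesis
          unfolding distrib_left mult.left_commute[of \<epsilon> 2] by linarith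
      qed
      moreover have "2 * real s + real t - 3 * real m \<le> real (list_chromatic_number (book a b p R))"
        using 1 2 3 by linarith
      moreover have "(1 - \<epsilon>) * (2 * real s + real t)
          = (2 * real s + real t) - \<epsilon> * (2 * real s + real t)"
        by (simp only: left_diff_distrib mult_1)
      ultimately show ?thesis
        by argo
    qed
    ultimately show "\<exists>G :: nat pair_pre_digraph. pair_graph G \<and>
        \<not> has_minor G (complete_bipartite s t) \<and>
        real (list_chromatic_number G) > (1 - \<epsilon>) * (2 * real s + real t)"
      using pair_graph_book by blast
  qed
qed

end
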